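(* Let $G=(V,E,w)$ be a finite weighted directed graph with nonempty boundary $\partial V\subset V$, and suppose that $G$ is connected to the boundary $\partial V$. Let $F$ be a partial differential equation on $G$, given by $F(u)(x)=f(x,u(x),\nabla u(x))$ for $x\in V\setminus\partial V$ and $F(u)(x)=g(x)-u(x)$ for $x\in\partial V$, and suppose that $F$ is uniformly elliptic in $G$. Then the comparison principle holds for $F$ in $G$: for all functions $u,v:V\to\mathbb{R}$, if $F(u)(x)\ge F(v)(x)$ for all $x\in V$, then $u(x)\le v(x)$ for all $x\in V$.
   Context: $G=(V,E,w)$ is a finite weighted directed graph: $V$ is a finite set of vertices, $E\subset V\times V$ is a set of oriented edges $e_{xy}=(x,y)$ from $x$ to $y$, and $w$ assigns a weight $w_{xy}>0$ to each edge $e_{xy}$ joining different vertices. A nonempty subset $\partial V\subset V$ is fixed, called the boundary; vertices of $V\setminus\partial V$ are called interior. A vertex $y\neq x$ is a neighbor of $x$ if there is an edge from $x$ to $y$; $d(x)$ is the number of neighbors of $x$, and it is assumed that $d(x)\ge 1$ for every interior $x$. For each $x$ an ordering $y_1,\dots,y_{d(x)}$ of the neighbors of $x$ is fixed. The graph is connected to the boundary if for every $x\in V$ there is a $y\in\partial V$ and a finite path from $x$ to $y$ proceeding from each vertex to one of its neighbors (i.e. following directed edges). For $u:V\to\mathbb{R}$ and interior $x$, the gradient is $\nabla u(x)=\big(w_{xy_1}(u(y_1)-u(x)),\dots,w_{xy_{d(x)}}(u(y_{d(x)})-u(x))\big)\in\mathbb{R}^{d(x)}$. A partial differential equation $F$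 on $G$ is specified by a real-valued function $f(x,r,\mathbf{p})$ defined for interior $x$, $r\in\mathbb{R}$, $\mathbf{p}\in\mathbb{R}^{d(x)}$, and a function $g:\partial V\to\mathbb{R}$; it maps a function $u:V\to\mathbb{R}$ to the function $F(u):V\to\mathbb{R}$ given by $F(u)(x)=f(x,u(x),\nabla u(x))$ for $x\in V\setminus\partial V$ and $F(u)(x)=g(x)-u(x)$ for $x\in\partial V$. For vectors, $\mathbf{p}\le\mathbf{q}$ means $p_i\le q_i$ for all $i$; $\mathbf{p}<\mathbf{q}$ means $\mathbf{p}\le\mathbf{q}$ and $p_i<q_i$ for some $i$. $F$ is uniformly elliptic in $G$ if for every interior $x$, all $r,s\in\mathbb{R}$ and all $\mathbf{p},\mathbf{q}\in\mathbb{R}^{d(x)}$: $r\ge s$ and $\mathbf{p}<\mathbf{q}$ imply $f(x,r,\mathbf{p})<f(x,s,\mathbf{q})$. *)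

theory Defs
  imports Complex_Main
begin

record 'v boundary_graph =
  verts :: "'v set"
  edges :: "('v \<times> 'v) set"
  weight :: "'v \<Rightarrow> 'v \<Rightarrow> real"
  bdry :: "'v set"
  nbr_list :: "'v \<Rightarrow> 'v list"

definition neighbors :: "'v boundary_graph \<Rightarrow> 'v \<Rightarrow> 'v set" where
  "neighbors G x = {y. y \<noteq> x \<and> (x, y) \<in> edges G}"

definition degree :: "'v boundary_graph \<Rightarrow> 'v \<Rightarrow> nat" where
  "degree G x = card (neighbors G x)"

definition interior_verts :: "'v boundary_graph \<Rightarrow> 'v set" where
  "interior_verts G = verts G - bdry G"

text \<open>Loops are allowed, but carry no weight condition and do not count as neighbors. The list
  \<open>nbr_list G x\<close> is the chosen enumeration of the neighbors of \<open>x\<close>.\<close>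

locale weighted_boundary_graph =
  fixes G :: "'v boundary_graph"
  assumes finite_verts: "finite (verts G)"
    and edges_subset: "edges G \<subseteq> verts G \<times> verts G"
    and weight_pos: "\<And>x y. (x, y) \<in> edges G \<Longrightarrow> x \<noteq> y \<Longrightarrow> weight G x y > 0"
    and bdry_subset: "bdry G \<subseteq> verts G"
    and bdry_nonempty: "bdry G \<noteq> {}"
    and degree_interior: "\<And>x. x \<in> interior_verts G \<Longrightarrow> degree G x \<ge> 1"
    and set_nbr_list: "\<And>x. x \<in> verts G \<Longrightarrow> set (nbr_list G x) = neighbors G x"
    and distinct_nbr_list: "\<And>x. x \<in> verts G \<Longrightarrow> distinct (nbr_list G x)"

text \<open>Paths may have length zero, so the condition is trivial for boundary vertices.\<close>

definition connected_to_boundary :: "'v boundary_graph \<Rightarrow> bool" where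
  "connected_to_boundary G \<longleftrightarrow>
    (\<forall>x\<in>verts G. \<exists>y\<in>bdry G. (x, y) \<in> {(a, b). b \<in> neighbors G a}\<^sup>*)"

text \<open>The dimension of the gradient varies with the vertex \<open>x\<close>, so its values are real lists of
  length \<open>degree G x\<close>. The order is componentwise, and \<open>vec_less\<close> requires strict
  inequality in at least one component only.\<close>

definition vec_le :: "real list \<Rightarrow> real list \<Rightarrow> bool" where
  "vec_le p q \<longleftrightarrow> length p = length q \<and> (\<forall>i<length p. p ! i \<le> q ! i)"

definition vec_less :: "real list \<Rightarrow> real list \<Rightarrow> bool" where
  "vec_less p q \<longleftrightarrow> vec_le p q \<and> (\<exists>i<length p. p ! i < q ! i)"

definition gradient :: "'v boundary_graph \<Rightarrow> ('v \<Rightarrow> real) \<Rightarrow> 'v \<Rightarrow> real list" where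
  "gradient G u x = map (\<lambda>y. weight G x y * (u y - u x)) (nbr_list G x)"

text \<open>Functions on \<open>verts G\<close>, \<open>bdry G\<close> and so on are total functions whose values outside their
  domain are irrelevant: \<open>pde G f g u x\<close> is meaningful for \<open>x \<in> verts G\<close> only, and there it
  depends only on \<open>u\<close> restricted to \<open>verts G\<close>, on \<open>g\<close> restricted to \<open>bdry G\<close>, and on
  \<open>f x r p\<close> for interior \<open>x\<close> and \<open>length p = degree G x\<close>.\<close>

definition pde :: "'v boundary_graph \<Rightarrow> ('v \<Rightarrow> real \<Rightarrow> real list \<Rightarrow> real) \<Rightarrow>
    ('v \<Rightarrow> real) \<Rightarrow> ('v \<Rightarrow> real) \<Rightarrow> ('v \<Rightarrow> real)" where
  "pde G f g u = (\<lambda>x. if x \<in> bdry G then g x - u x else f x (u x) (gradient G u x))"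

definition uniformly_elliptic ::
    "'v boundary_graph \<Rightarrow> ('v \<Rightarrow> real \<Rightarrow> real list \<Rightarrow> real) \<Rightarrow> bool" where
  "uniformly_elliptic G f \<longleftrightarrow>
    (\<forall>x\<in>interior_verts G. \<forall>r s p q. length p = degree G x \<longrightarrow> length q = degree G x \<longrightarrow>
      r \<ge> s \<longrightarrow> vec_less p q \<longrightarrow> f x r p < f x s q)"

definition comparison_principle ::
    "'v boundary_graph \<Rightarrow> (('v \<Rightarrow> real) \<Rightarrow> ('v \<Rightarrow> real)) \<Rightarrow> bool" where
  "comparison_principle G F \<longleftrightarrow>
    (\<forall>u v. (\<forall>x\<in>verts G. F u x \<ge> F v x) \<longrightarrow> (\<forall>x\<in>verts G. u x \<le> v x))"

end

theory Submission
  imports Defs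
begin

text \<open>The comparison principle is a maximum principle for the difference \<open>u - v\<close>. Suppose that its
  maximum \<open>M\<close> over the finite vertex set is positive. At an interior vertex where \<open>M\<close> is attained,
  every component of the gradient of \<open>u\<close> is at most that of \<open>v\<close>, because \<open>u - v\<close> does not increase
  along any outgoing edge (\<open>gradient_strictly_less\<close>). A single neighbor at which \<open>u - v\<close> is smaller
  than \<open>M\<close> would make one of these inequalities strict, and uniform ellipticity would then
  contradict \<open>F(u) \<ge> F(v)\<close>. Hence the value \<open>M\<close> is inherited by all neighbors
  (\<open>maximum_spreads_to_neighbors\<close>), and so it travels along a directed path to the boundary.
  There \<open>F(u) \<ge> F(v)\<close> says \<open>u \<le> v\<close>, which is incompatible with \<open>M > 0\<close>.\<close>

context weighted_boundary_graph
begin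

lemma neighbors_subset_verts: "neighbors G x \<subseteq> verts G"
  using edges_subset by (auto simp: neighbors_def)

lemma length_gradient: "x \<in> verts G \<Longrightarrow> length (gradient G u x) = degree G x"
  by (simp add: gradient_def degree_def set_nbr_list distinct_nbr_list flip: distinct_card)

text \<open>The weights are positive, so comparing the two gradients at \<open>x\<close> componentwise amounts to
  comparing \<open>u y - v y\<close> with \<open>u x - v x\<close> for the neighbors \<open>y\<close> of \<open>x\<close>.\<close>

lemma gradient_strictly_less:
  assumes x: "x \<in> verts G"
    and max_at_x: "\<And>y. y \<in> neighbors G x \<Longrightarrow> u y - v y \<le> u x - v x"
    and z: "z \<in> neighbors G x" "u z - v z < u x - v x"
  shows "vec_less (gradient G u x) (gradient G v x)"
proof -
  have pos: "weight G x y > 0" if "y \<in> neighbors G x" for y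
    using that weight_pos by (auto simp: neighbors_def)
  have nbr: "nbr_list G x ! i \<in> neighbors G x" if "i < length (nbr_list G x)" for i
    using that set_nbr_list[OF x] nth_mem by blast
  have "weight G x y * (u y - u x) \<le> weight G x y * (v y - v x)" if "y \<in> neighbors G x" for y
    using pos[OF that] max_at_x[OF that] by (intro mult_left_mono) auto
  then have "vec_le (gradient G u x) (gradient G v x)"
    using nbr by (simp add: vec_le_def gradient_def)
  moreover obtain i where "i < length (nbr_list G x)" "nbr_list G x ! i = z"
    using z(1) set_nbr_list[OF x] by (metis in_set_conv_nth)
  moreover have "weight G x z * (u z - u x) < weight G x z * (v z - v x)"
    using pos[OF z(1)] z(2) by (intro mult_strict_left_mono) auto
  ultimately show ?thesis
    by (auto simp: vec_less_def gradient_def)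
qed

text \<open>Nonnegativity of the maximum supplies the condition \<open>u x \<ge> v x\<close> under which ellipticity turns
  a strict inequality of gradients into a strict inequality of the values of \<open>f\<close>.\<close>

lemma maximum_spreads_to_neighbors:
  assumes elliptic: "uniformly_elliptic G f"
    and x: "x \<in> interior_verts G"
    and ineq: "f x (v x) (gradient G v x) \<le> f x (u x) (gradient G u x)"
    and nonneg: "u x - v x \<ge> 0"
    and max_at_x: "\<And>y. y \<in> verts G \<Longrightarrow> u y - v y \<le> u x - v x"
    and y: "y \<in> neighbors G x"
  shows "u y - v y = u x - v x"
proof (rule ccontr)
  assume neq: "u y - v y \<noteq> u x - v x"
  have nbr_le: "u z - v z \<le> u x - v x" if "z \<in> neighbors G x" for z
    using max_at_x neighbors_subset_verts that by blast
  have xV: "x \<in> verts G"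
    using x by (simp add: interior_verts_def)
  have "u y - v y < u x - v x"
    using nbr_le[OF y] neq by linarith
  with xV nbr_le y have "vec_less (gradient G u x) (gradient G v x)"
    by (intro gradient_strictly_less)
  then have "f x (u x) (gradient G u x) < f x (v x) (gradient G v x)"
    using elliptic x nonneg length_gradient[OF xV] by (simp add: uniformly_elliptic_def)
  with ineq show False
    by simp
qed

end

theorem theorem1:
  fixes G :: "'v boundary_graph"
    and f :: "'v \<Rightarrow> real \<Rightarrow> real list \<Rightarrow> real"
    and g :: "'v \<Rightarrow> real"
  assumes "weighted_boundary_graph G"
    and "connected_to_boundary G"
    and "uniformly_elliptic G f"
  shows "comparison_principle G (pde G f g)"
  unfolding comparison_principle_def
proof (intro allI impI ballI)
  interpret weighted_boundary_graph G by fact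
  fix u v x0
  assume ineq: "\<forall>x\<in>verts G. pde G f g u x \<ge> pde G f g v x"
    and x0: "x0 \<in> verts G"
  have bdry_le: "u x \<le> v x" if "x \<in> bdry G" for x
    using ineq bdry_subset that by (force simp: pde_def)
  define M where "M = Max ((\<lambda>x. u x - v x) ` verts G)"
  have le_M: "u x - v x \<le> M" if "x \<in> verts G" for x
    using that finite_verts by (simp add: M_def)
  have "M \<in> (\<lambda>x. u x - v x) ` verts G"
    unfolding M_def using finite_verts x0 by (intro Max_in) auto
  then obtain a where a: "a \<in> verts G" "u a - v a = M"
    by auto
  have "M \<le> 0"
  proof (rule ccontr)
    assume "\<not> M \<le> 0"
    then have pos: "M > 0"
      by simp
    obtain b where b: "b \<in> bdry G" "(a, b) \<in> {(a, b). b \<in> neighbors G a}\<^sup>*"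
      using assms(2) a(1) by (auto simp: connected_to_boundary_def)
    from b(2) have "b \<in> verts G \<and> u b - v b = M"
    proof (induction rule: rtrancl_induct)
      case base
      show ?case using a by simp
    next
      case (step y z)
      then have y: "y \<in> verts G" "u y - v y = M" and z: "z \<in> neighbors G y"
        by auto
      have "y \<notin> bdry G"
        using bdry_le y(2) pos by force
      then have "y \<in> interior_verts G"
        and "f y (v y) (gradient G v y) \<le> f y (u y) (gradient G u y)"
        using y(1) ineq by (auto simp: interior_verts_def pde_def)
      with assms(3) have "u z - v z = u y - v y"
        using le_M y(2) z pos by (intro maximum_spreads_to_neighbors) auto
      then show ?case
        using y(2) z neighbors_subset_verts by auto
    qed
    then show False
      using bdry_le[OF b(1)] pos by simp
  qed
  then show "u x0 \<le> v x0"
    using le_M[OF x0] by linarith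
qed

end
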